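(* Consider the estimation problem [OCMT-MNL-EST] and the memoized dynamic program (Algorithm) described in the context. If each finite leaf cost $H(\mathcal D_s)$ is evaluated exactly (value and minimizing parameter), the Algorithm returns an optimal solution $(\mathbb T^*,\{\bm\theta_k^*\})$ of [OCMT-MNL-EST] over the tree class $\mathfrak T(\mathcal F',D,N_{\min})$. When the leaf solver is run to numerical tolerance $\varepsilon$, let $m_\Theta$ be the number of linear constraints defining $\Theta$, let $\overline m_{\mathrm{Newt}}(N,\varepsilon)$ be the maximum number of constrained Newton iterations for a feasible leaf with at most $N$ observations, and let $\mathcal T_{\mathrm{QP}}(N_0,m_\Theta,\varepsilon)$ be the cost of one constrained Newton quadratic-program solve. Then the running time of the Algorithm is $$ O\!\left( \left\{\sum_{d=0}^{D}\binom{|\mathcal F'|}{d}2^d\right\} \left[ \overline m_{\mathrm{Newt}}(N,\varepsilon) \left\{NN_0^2+m_{\Theta}N_0+\mathcal T_{\mathrm{QP}}(N_0,m_\Theta,\varepsilon)\right\} +|\mathcal F'|N \right] \right). $$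
   Context: Data and model. $\mathcal J$ is a finite nonempty set of products, $0$ denotes no purchase, $\mathcal F$ is a finite set of covariates. The data set is $\mathcal D=\{(\bm x_i,\bm p_i,y_i)\}_{i\in\mathcal I}$, $N=|\mathcal I|$, with $\bm x_i\in\mathcal X\subset\mathbb R^{|\mathcal F|}$ ($\mathcal X$ compact), $\bm p_i\in\mathbb R_+^{|\mathcal J|}$, $y_i\in\{0\}\cup\mathcal J$. A parameter is $\bm\theta=(\bm\alpha,\bm\beta,\bm\gamma)\in\mathbb R^{|\mathcal J|}\times\mathbb R^{|\mathcal F|}\times\mathbb R^{|\mathcal J|}=\mathbb R^{N_0}$ with $N_0=2|\mathcal J|+|\mathcal F|$. Utilities are $u_j(\bm x,\bm p,\bm\theta)=\alpha_j+\bm\beta^\top\bm x-\gamma_jp_j$ for $j\in\mathcal J$ and $u_0=0$; multinomial logit (MNL) probabilities are $\pi_{ij}(\bm\theta)=e^{u_j(\bm x_i,\bm p_i,\bm\theta)}/\sum_{l\in\{0\}\cup\mathcal J}e^{u_l(\bm x_i,\bm p_i,\bm\theta)}$, and $\ell_i(\bm\theta)=-\log\pi_{i,y_i}(\bm\theta)$. The feasible set $\Theta=\{\bm\theta:\bm A_\Theta\bm\theta\le\bm b_\Theta\}$ is a nonempty closed polyhedron, whose constraints include $\gamma_j\ge\underline\gamma$ for all $j$, for a fixed $\underline\gamma>0$. A penalty $\lambda\ge0$, a minimum leaf size $N_{\min}\in\{1,\dots,N\}$ and a maximum depth $D$ are given. Trees. $\mathcal F'$ is a finite set of binary split candidates;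 each $f\in\mathcal F'$ is a $\{0,1\}$-valued function of the feature vector (a binary covariate or a threshold indicator of a numerical covariate), and $z_{if}\in\{0,1\}$ is its value at observation $i$. $\mathfrak T(\mathcal F',D,N_{\min})$ is the set of binary trees of depth at most $D$ whose internal nodes split on candidates in $\mathcal F'$ and each of whose leaves receives at least $N_{\min}$ observations. A tree $\mathbb T$ has $K(\mathbb T)$ leaves, partitioning observations into index sets $\mathcal I_k(\mathbb T)$. Leaf cost. For $\mathcal D_s\subseteq\mathcal D$ with index set $\mathcal S$, $H(\mathcal D_s)=\min_{\bm\theta\in\Theta}\{\sum_{i\in\mathcal S}\ell_i(\bm\theta)+\lambda N_0\}$ if $|\mathcal D_s|\ge N_{\min}$ and $H(\mathcal D_s)=+\infty$ otherwise. It is assumed that every finite leaf problem attains its minimum. [OCMT-MNL-EST]: minimize $\sum_{k=1}^{K(\mathbb T)}\sum_{i\in\mathcal I_k(\mathbb T)}\ell_i(\bm\theta_k)+\lambda K(\mathbb T)N_0$ over $\mathbb T\in\mathfrak T(\mathcal F',D,N_{\min})$ and $\bm\theta_k\in\Theta$, $k=1,\dots,K(\mathbb T)$. Algorithm. For $f\in\mathcal F'$, $b\in\{0,1\}$, let $\mathcal D_s^{f=b}$ be the observations of $\mathcal D_s$ with $z_{if}=b$. For $d<D$ let $\mathcal A(\mathcal D_s,d)=\{f\in\mathcal F':\min\{|\mathcal D_s^{f=0}|,|\mathcal D_s^{f=1}|\}\ge N_{\min}\}$, and $\mathcal A(\mathcal D_s,D)=\varnothing$. The recursive procedure SolveState$(\mathcal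 D_s,d)$: (1) if $(\mathcal D_s,d)$ is cached, return the cached value; (2) if $|\mathcal D_s|<N_{\min}$, cache and return $+\infty$; (3) compute or retrieve $H(\mathcal D_s)$ and a minimizer $\bm\theta^*(\mathcal D_s)$, set $v^*\leftarrow H(\mathcal D_s)$ and $a^*\leftarrow$ Leaf; (4) if $d<D$, for each $f\in\mathcal A(\mathcal D_s,d)$ set $v_f\leftarrow$ SolveState$(\mathcal D_s^{f=0},d+1)$ + SolveState$(\mathcal D_s^{f=1},d+1)$, and if $v_f<v^*$ set $v^*\leftarrow v_f$, $a^*\leftarrow f$; (5) cache $(v^*,a^* )$ for $(\mathcal D_s,d)$ and the leaf fit for $\mathcal S$; return $v^*$. The Algorithm calls SolveState$(\mathcal D,0)$ and recovers the tree and leaf parameters by backtracking the cached actions from the root. Leaf solver and cost model. Leaf costs are computed by constrained Newton (sequential quadratic programming with exact Hessian, damped line search): at a feasible iterate with gradient $\bm g_t$ and Hessian $\bm G_t$ of $\sum_{i\in\mathcal S}\ell_i$, it solves $\min_{\bm d}\{\bm g_t^\top\bm d+\tfrac12\bm d^\top\bm G_t\bm d:\bm A_\Theta(\bm\theta_t+\bm d)\le\bm b_\Theta\}$. One iteration on $n$ observations costs $O(nN_0^2)$ for probabilities, gradient and Hessian, $O(m_\Theta N_0)$ for processing the linear constraints, plus one quadratic-program solve of cost $\mathcal T_{\mathrm{QP}}(N_0,m_\Theta,\varepsilon)$. Partitioning $\mathcal D_s$ by one candidate $f$ costs $O(|\mathcal D_s|)$; cache access is not charged separately. *)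

theory Defs
  imports "HOL-Analysis.Analysis" "HOL-Library.Landau_Symbols"
begin

section \<open>Data and model\<close>

text \<open>
  All index sets are explicit finite carriers inside types, not types themselves: the constants
  hidden in the O-notation must be uniform in the numbers of products, covariates, candidates and
  observations, so these sizes have to be quantified inside a formula.
\<close>

text \<open>Coordinates of a parameter vector $(\alpha,\beta,\gamma)$.\<close>

datatype ('j, 'f) coord = Alpha 'j | Beta 'f | Gamma 'j

type_synonym ('j, 'f) param = "('j, 'f) coord \<Rightarrow> real"
type_synonym 'f candidate = "('f \<Rightarrow> real) \<Rightarrow> bool"

text \<open>
  The split candidates are given in the order in which the algorithm loops over them; the
  mathematical set of candidates is \<open>set (cands P)\<close>. The feasible parameters are cut out by the
  constraints \<open>r < n_cons P\<close>, with coefficient vectors \<open>con_lhs P r\<close> and right-hand sides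
  \<open>con_rhs P r\<close>.
\<close>

record ('i, 'j, 'f) problem =
  products :: "'j set"
  covariates :: "'f set"
  feature_space :: "('f \<Rightarrow> real) set"
  obs :: "'i set"
  features :: "'i \<Rightarrow> 'f \<Rightarrow> real"
  prices :: "'i \<Rightarrow> 'j \<Rightarrow> real"
  choice_of :: "'i \<Rightarrow> 'j option"  \<comment> \<open>\<open>None\<close> is the no-purchase alternative\<close>
  n_cons :: nat
  con_lhs :: "nat \<Rightarrow> ('j, 'f) param"
  con_rhs :: "nat \<Rightarrow> real"
  gamma_min :: real
  penalty :: real
  min_leaf :: nat
  max_depth :: nat
  cands :: "'f candidate list"

definition coords :: "('i, 'j, 'f) problem \<Rightarrow> ('j, 'f) coord set" where
  "coords P = Alpha ` products P \<union> Beta ` covariates P \<union> Gamma ` products P"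

definition n_params :: "('i, 'j, 'f) problem \<Rightarrow> nat" where
  "n_params P = 2 * card (products P) + card (covariates P)"

definition alternatives :: "('i, 'j, 'f) problem \<Rightarrow> 'j option set" where
  "alternatives P = insert None (Some ` products P)"

definition utility ::
  "('i, 'j, 'f) problem \<Rightarrow> ('f \<Rightarrow> real) \<Rightarrow> ('j \<Rightarrow> real) \<Rightarrow> ('j, 'f) param \<Rightarrow> 'j option \<Rightarrow> real" where
  "utility P x p \<theta> k = (case k of None \<Rightarrow> 0
     | Some j \<Rightarrow> \<theta> (Alpha j) + (\<Sum>f\<in>covariates P. \<theta> (Beta f) * x f) - \<theta> (Gamma j) * p j)"

definition mnl_prob ::
  "('i, 'j, 'f) problem \<Rightarrow> 'i \<Rightarrow> ('j, 'f) param \<Rightarrow> 'j option \<Rightarrow> real" where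
  "mnl_prob P i \<theta> k = exp (utility P (features P i) (prices P i) \<theta> k) /
     (\<Sum>l\<in>alternatives P. exp (utility P (features P i) (prices P i) \<theta> l))"

definition obs_loss :: "('i, 'j, 'f) problem \<Rightarrow> 'i \<Rightarrow> ('j, 'f) param \<Rightarrow> real" where
  "obs_loss P i \<theta> = - ln (mnl_prob P i \<theta> (choice_of P i))"

definition loss :: "('i, 'j, 'f) problem \<Rightarrow> 'i set \<Rightarrow> ('j, 'f) param \<Rightarrow> real" where
  "loss P S \<theta> = (\<Sum>i\<in>S. obs_loss P i \<theta>)"

definition feasible_params :: "('i, 'j, 'f) problem \<Rightarrow> ('j, 'f) param set" where
  "feasible_params P = {\<theta> \<in> coords P \<rightarrow>\<^sub>E UNIV.
     \<forall>r<n_cons P. (\<Sum>c\<in>coords P. con_lhs P r c * \<theta> c) \<le> con_rhs P r}"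

definition valid_problem :: "('i, 'j, 'f) problem \<Rightarrow> bool" where
  "valid_problem P \<longleftrightarrow>
     finite (products P) \<and> products P \<noteq> {} \<and> finite (covariates P) \<and> finite (obs P) \<and>
     compactin (product_topology (\<lambda>_. euclideanreal) (covariates P)) (feature_space P) \<and>
     (\<forall>i\<in>obs P. features P i \<in> feature_space P \<and>
                 prices P i \<in> products P \<rightarrow>\<^sub>E {0..} \<and>
                 choice_of P i \<in> alternatives P) \<and>
     feasible_params P \<noteq> {} \<and>
     0 < gamma_min P \<and>
     (\<forall>j\<in>products P. \<exists>r<n_cons P.
        (\<forall>c\<in>coords P. con_lhs P r c = (if c = Gamma j then -1 else 0)) \<and>
        con_rhs P r = - gamma_min P) \<and>
     0 \<le> penalty P \<and>
     1 \<le> min_leaf P \<and> min_leaf P \<le> card (obs P) \<and>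
     distinct (cands P) \<and>
     (\<forall>S\<subseteq>obs P. min_leaf P \<le> card S \<longrightarrow>
        (\<exists>\<theta>\<in>feasible_params P. \<forall>\<theta>'\<in>feasible_params P. loss P S \<theta> \<le> loss P S \<theta>'))"

text \<open>A subset of the data set is represented by its index set \<open>S\<close>.\<close>

definition branch ::
  "('i, 'j, 'f) problem \<Rightarrow> 'i set \<Rightarrow> 'f candidate \<Rightarrow> bool \<Rightarrow> 'i set" where
  "branch P S f b = {i \<in> S. f (features P i) = b}"

definition leaf_cost :: "('i, 'j, 'f) problem \<Rightarrow> 'i set \<Rightarrow> ereal" where
  "leaf_cost P S = (if min_leaf P \<le> card S
     then (INF \<theta>\<in>feasible_params P. ereal (loss P S \<theta> + penalty P * real (n_params P)))
     else \<infinity>)"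


section \<open>Trees and the estimation problem\<close>

text \<open>
  A tree carries the parameter vectors of its leaves, so one value of this type is a pair of a tree
  and a family of leaf parameters. \<open>Node f l r\<close> sends observations with $f = 0$ to \<open>l\<close>
  and those with $f = 1$ to \<open>r\<close>.
\<close>

datatype ('s, 'p) tree = Leaf 'p | Node 's "('s, 'p) tree" "('s, 'p) tree"

primrec depth :: "('s, 'p) tree \<Rightarrow> nat" where
  "depth (Leaf \<theta>) = 0"
| "depth (Node f l r) = Suc (max (depth l) (depth r))"

primrec splits :: "('s, 'p) tree \<Rightarrow> 's set" where
  "splits (Leaf \<theta>) = {}"
| "splits (Node f l r) = insert f (splits l \<union> splits r)"

primrec leaves ::
  "('i, 'j, 'f) problem \<Rightarrow> ('f candidate, 'p) tree \<Rightarrow> 'i set \<Rightarrow> ('i set \<times> 'p) list" where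
  "leaves P (Leaf \<theta>) S = [(S, \<theta>)]"
| "leaves P (Node f l r) S = leaves P l (branch P S f False) @ leaves P r (branch P S f True)"

definition feasible_tree ::
  "('i, 'j, 'f) problem \<Rightarrow> ('f candidate, ('j, 'f) param) tree \<Rightarrow> bool" where
  "feasible_tree P t \<longleftrightarrow> depth t \<le> max_depth P \<and> splits t \<subseteq> set (cands P) \<and>
     (\<forall>(S, \<theta>) \<in> set (leaves P t (obs P)). min_leaf P \<le> card S \<and> \<theta> \<in> feasible_params P)"

definition tree_objective ::
  "('i, 'j, 'f) problem \<Rightarrow> ('f candidate, ('j, 'f) param) tree \<Rightarrow> real" where
  "tree_objective P t = (\<Sum>(S, \<theta>) \<leftarrow> leaves P t (obs P). \<Sum>i\<in>S. obs_loss P i \<theta>) +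
     penalty P * real (length (leaves P t (obs P))) * real (n_params P)"

definition optimal_tree ::
  "('i, 'j, 'f) problem \<Rightarrow> ('f candidate, ('j, 'f) param) tree \<Rightarrow> bool" where
  "optimal_tree P t \<longleftrightarrow> feasible_tree P t \<and>
     (\<forall>t'. feasible_tree P t' \<longrightarrow> tree_objective P t \<le> tree_objective P t')"


section \<open>Cost model\<close>

text \<open>
  \<open>step_cost\<close> is a unit for the bookkeeping of one state, one candidate or one node of the recovered
  tree (size test, addition, comparison); the remaining fields are the costs, as functions of the
  sizes, of partitioning $n$ observations, of probabilities, gradient and Hessian for $n$
  observations and $N_0$ parameters, of processing $m$ constraints on $N_0$ parameters, and of one
  quadratic program.
\<close>

record cost_model =
  step_cost :: real
  part_cost :: "nat \<Rightarrow> real"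
  deriv_cost :: "nat \<Rightarrow> nat \<Rightarrow> real"
  con_cost :: "nat \<Rightarrow> nat \<Rightarrow> real"
  qp_cost :: "nat \<Rightarrow> nat \<Rightarrow> real \<Rightarrow> real"

definition valid_cost_model :: "cost_model \<Rightarrow> bool" where
  "valid_cost_model C \<longleftrightarrow>
     0 \<le> step_cost C \<and> (\<forall>n. 0 \<le> part_cost C n) \<and> (\<forall>n k. 0 \<le> deriv_cost C n k) \<and>
     (\<forall>m k. 0 \<le> con_cost C m k) \<and> (\<forall>k m \<epsilon>. 0 \<le> qp_cost C k m \<epsilon>) \<and>
     part_cost C \<in> O[principal {1..}](\<lambda>n. real n) \<and>
     (\<lambda>(n, k). deriv_cost C n k) \<in> O[principal ({1..} \<times> {1..})](\<lambda>(n, k). real n * (real k)\<^sup>2) \<and>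
     (\<lambda>(m, k). con_cost C m k) \<in> O[principal ({1..} \<times> {1..})](\<lambda>(m, k). real m * real k)"


section \<open>The memoized dynamic program\<close>

datatype 's action = Fit_Leaf | Split_On 's

text \<open>The action is \<open>None\<close> for states that have too few observations.\<close>

record ('i, 's, 'p) memo =
  state_cache :: "('i set \<times> nat) \<rightharpoonup> (ereal \<times> 's action option)"
  fit_cache :: "'i set \<rightharpoonup> (real \<times> 'p)"
  clock :: real

definition empty_memo :: "('i, 's, 'p) memo" where
  "empty_memo = \<lparr>state_cache = Map.empty, fit_cache = Map.empty, clock = 0\<rparr>"

definition charge :: "real \<Rightarrow> ('i, 's, 'p) memo \<Rightarrow> ('i, 's, 'p) memo" where
  "charge c m = m\<lparr>clock := clock m + c\<rparr>"

definition store_state ::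
  "'i set \<Rightarrow> nat \<Rightarrow> ereal \<times> 's action option \<Rightarrow> ('i, 's, 'p) memo \<Rightarrow> ('i, 's, 'p) memo" where
  "store_state S d va m = m\<lparr>state_cache := (state_cache m)((S, d) \<mapsto> va)\<rparr>"

definition store_fit ::
  "'i set \<Rightarrow> real \<times> 'p \<Rightarrow> ('i, 's, 'p) memo \<Rightarrow> ('i, 's, 'p) memo" where
  "store_fit S h\<theta> m = m\<lparr>fit_cache := (fit_cache m)(S \<mapsto> h\<theta>)\<rparr>"

definition admissible :: "('i, 'j, 'f) problem \<Rightarrow> 'i set \<Rightarrow> nat \<Rightarrow> 'f candidate set" where
  "admissible P S d = (if d < max_depth P
     then {f \<in> set (cands P).
             min_leaf P \<le> min (card (branch P S f False)) (card (branch P S f True))}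
     else {})"

text \<open>
  A leaf solver maps an index set to a value and a parameter vector; \<open>tm S\<close> is the time it takes on
  \<open>S\<close>.
\<close>

definition get_fit ::
  "('i set \<Rightarrow> real \<times> 'p) \<Rightarrow> ('i set \<Rightarrow> real) \<Rightarrow> 'i set \<Rightarrow> ('i, 's, 'p) memo
     \<Rightarrow> (real \<times> 'p) \<times> ('i, 's, 'p) memo" where
  "get_fit fit tm S m = (case fit_cache m S of
       Some h\<theta> \<Rightarrow> (h\<theta>, m)
     | None \<Rightarrow> (fit S, charge (tm S) m))"

text \<open>
  \<open>try_cands\<close> is the loop over the candidates in state \<open>(S, d)\<close>, with the incumbent value and action
  as accumulators. Every candidate has to be partitioned in order to test its admissibility; the two
  parts are then reused by the recursive calls.
\<close>

function (sequential)
  solve_state ::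
    "('i, 'j, 'f) problem \<Rightarrow> cost_model \<Rightarrow> ('i set \<Rightarrow> real \<times> 'p) \<Rightarrow> ('i set \<Rightarrow> real)
      \<Rightarrow> 'i set \<Rightarrow> nat \<Rightarrow> ('i, 'f candidate, 'p) memo \<Rightarrow> ereal \<times> ('i, 'f candidate, 'p) memo"
and try_cands ::
    "('i, 'j, 'f) problem \<Rightarrow> cost_model \<Rightarrow> ('i set \<Rightarrow> real \<times> 'p) \<Rightarrow> ('i set \<Rightarrow> real)
      \<Rightarrow> 'i set \<Rightarrow> nat \<Rightarrow> 'f candidate list \<Rightarrow> ereal \<Rightarrow> 'f candidate action
      \<Rightarrow> ('i, 'f candidate, 'p) memo
      \<Rightarrow> ereal \<times> 'f candidate action \<times> ('i, 'f candidate, 'p) memo"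
where
  "solve_state P C fit tm S d m =
    (case state_cache m (S, d) of
       Some (v, a) \<Rightarrow> (v, m)
     | None \<Rightarrow>
        (let m1 = charge (step_cost C) m in
         if card S < min_leaf P then (\<infinity>, store_state S d (\<infinity>, None) m1)
         else
           (let (h\<theta>, m2) = get_fit fit tm S m1;
                (v, a, m3) =
                  (if d < max_depth P
                   then try_cands P C fit tm S d (cands P) (ereal (fst h\<theta>)) Fit_Leaf m2
                   else (ereal (fst h\<theta>), Fit_Leaf, m2))
            in (v, store_fit S h\<theta> (store_state S d (v, Some a) m3)))))"
| "try_cands P C fit tm S d [] v a m = (v, a, m)"
| "try_cands P C fit tm S d (f # fs) v a m =
    (let m1 = charge (step_cost C + part_cost C (card S)) m in
     if f \<in> admissible P S d then
       (let (v0, m2) = solve_state P C fit tm (branch P S f False) (Suc d) m1;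
            (v1, m3) = solve_state P C fit tm (branch P S f True) (Suc d) m2
        in if v0 + v1 < v
           then try_cands P C fit tm S d fs (v0 + v1) (Split_On f) m3
           else try_cands P C fit tm S d fs v a m3)
     else try_cands P C fit tm S d fs v a m1)"
  by pat_completeness auto
termination
  by (relation "measures
       [\<lambda>x. case x of Inl (P, C, fit, tm, S, d, m) \<Rightarrow> max_depth P - d
                    | Inr (P, C, fit, tm, S, d, fs, v, a, m) \<Rightarrow> max_depth P - d,
        \<lambda>x. case x of Inl (P, C, fit, tm, S, d, m) \<Rightarrow> Suc (length (cands P))
                    | Inr (P, C, fit, tm, S, d, fs, v, a, m) \<Rightarrow> length fs]")
     (auto simp: admissible_def split: if_splits)

text \<open>
  Recovery of the tree from the cached actions, together with its running time. The last branch,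
  and the test of \<open>d\<close>, only make the function total.
\<close>

function backtrack ::
  "('i, 'j, 'f) problem \<Rightarrow> cost_model \<Rightarrow> ('i, 'f candidate, 'p) memo \<Rightarrow> 'i set \<Rightarrow> nat
     \<Rightarrow> ('f candidate, 'p) tree \<times> real" where
  "backtrack P C m S d =
    (case state_cache m (S, d) of
       Some (v, Some Fit_Leaf) \<Rightarrow> (Leaf (snd (the (fit_cache m S))), step_cost C)
     | Some (v, Some (Split_On f)) \<Rightarrow>
        (if d < max_depth P then
           (let (l, tl) = backtrack P C m (branch P S f False) (Suc d);
                (r, tr) = backtrack P C m (branch P S f True) (Suc d)
            in (Node f l r, step_cost C + part_cost C (card S) + tl + tr))
         else undefined)
     | _ \<Rightarrow> undefined)"
  by pat_completeness auto
termination
  by (relation "measures [\<lambda>(P, C, m, S, d). max_depth P - d]") auto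

definition run_algorithm ::
  "('i, 'j, 'f) problem \<Rightarrow> cost_model \<Rightarrow> ('i set \<Rightarrow> real \<times> 'p) \<Rightarrow> ('i set \<Rightarrow> real)
     \<Rightarrow> ('f candidate, 'p) tree \<times> real" where
  "run_algorithm P C fit tm =
    (let (v, m) = solve_state P C fit tm (obs P) 0 empty_memo;
         (t, tb) = backtrack P C m (obs P) 0
     in (t, clock m + tb))"

definition returned_tree ::
  "('i, 'j, 'f) problem \<Rightarrow> cost_model \<Rightarrow> ('i set \<Rightarrow> real \<times> 'p) \<Rightarrow> ('i set \<Rightarrow> real)
     \<Rightarrow> ('f candidate, 'p) tree" where
  "returned_tree P C fit tm = fst (run_algorithm P C fit tm)"

definition running_time ::
  "('i, 'j, 'f) problem \<Rightarrow> cost_model \<Rightarrow> ('i set \<Rightarrow> real \<times> 'p) \<Rightarrow> ('i set \<Rightarrow> real)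
     \<Rightarrow> real" where
  "running_time P C fit tm = snd (run_algorithm P C fit tm)"


section \<open>Leaf solvers\<close>

definition exact_fit ::
  "('i, 'j, 'f) problem \<Rightarrow> ('i set \<Rightarrow> real \<times> ('j, 'f) param) \<Rightarrow> bool" where
  "exact_fit P fit \<longleftrightarrow> (\<forall>S\<subseteq>obs P. min_leaf P \<le> card S \<longrightarrow>
     (case fit S of (h, \<theta>) \<Rightarrow>
        ereal h = leaf_cost P S \<and> \<theta> \<in> feasible_params P \<and>
        ereal (loss P S \<theta> + penalty P * real (n_params P)) = leaf_cost P S))"

definition grad ::
  "('i, 'j, 'f) problem \<Rightarrow> 'i set \<Rightarrow> ('j, 'f) param \<Rightarrow> ('j, 'f) coord \<Rightarrow> real" where
  "grad P S \<theta> c = deriv (\<lambda>t. loss P S (\<theta>(c := t))) (\<theta> c)"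

definition hess ::
  "('i, 'j, 'f) problem \<Rightarrow> 'i set \<Rightarrow> ('j, 'f) param \<Rightarrow> ('j, 'f) coord \<Rightarrow> ('j, 'f) coord \<Rightarrow> real"
where
  "hess P S \<theta> c c' = deriv (\<lambda>t. grad P S (\<theta>(c' := t)) c) (\<theta> c')"

definition qp_objective ::
  "('i, 'j, 'f) problem \<Rightarrow> 'i set \<Rightarrow> ('j, 'f) param \<Rightarrow> ('j, 'f) param \<Rightarrow> real" where
  "qp_objective P S \<theta> d = (\<Sum>c\<in>coords P. grad P S \<theta> c * d c) +
     1/2 * (\<Sum>c\<in>coords P. \<Sum>c'\<in>coords P. d c * hess P S \<theta> c c' * d c')"

definition qp_feasible ::
  "('i, 'j, 'f) problem \<Rightarrow> ('j, 'f) param \<Rightarrow> ('j, 'f) param set" where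
  "qp_feasible P \<theta> = {d \<in> coords P \<rightarrow>\<^sub>E UNIV.
     \<forall>r<n_cons P. (\<Sum>c\<in>coords P. con_lhs P r c * (\<theta> c + d c)) \<le> con_rhs P r}"

text \<open>The quadratic program is solved to the tolerance \<open>\<epsilon>\<close>; exact solutions are included.\<close>

definition qp_solution ::
  "('i, 'j, 'f) problem \<Rightarrow> real \<Rightarrow> 'i set \<Rightarrow> ('j, 'f) param \<Rightarrow> ('j, 'f) param \<Rightarrow> bool" where
  "qp_solution P \<epsilon> S \<theta> d \<longleftrightarrow> d \<in> qp_feasible P \<theta> \<and>
     (\<forall>d'\<in>qp_feasible P \<theta>. qp_objective P S \<theta> d \<le> qp_objective P S \<theta> d' + \<epsilon>)"

definition newton_step ::
  "('i, 'j, 'f) problem \<Rightarrow> real \<Rightarrow> 'i set \<Rightarrow> ('j, 'f) param \<Rightarrow> ('j, 'f) param \<Rightarrow> bool" where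
  "newton_step P \<epsilon> S \<theta> \<theta>' \<longleftrightarrow> (\<exists>d s. qp_solution P \<epsilon> S \<theta> d \<and> 0 < s \<and> s \<le> 1 \<and>
     \<theta>' = (\<lambda>c\<in>coords P. \<theta> c + s * d c) \<and> loss P S \<theta>' \<le> loss P S \<theta>)"

text \<open>
  A run is the list of its iterates, starting point included. It has at least one iteration, since
  the solver needs the derivatives at the starting point even to accept that point.
\<close>

definition newton_run ::
  "('i, 'j, 'f) problem \<Rightarrow> real \<Rightarrow> 'i set \<Rightarrow> ('j, 'f) param list \<Rightarrow> bool" where
  "newton_run P \<epsilon> S \<theta>s \<longleftrightarrow> 2 \<le> length \<theta>s \<and> hd \<theta>s \<in> feasible_params P \<and>
     (\<forall>t. Suc t < length \<theta>s \<longrightarrow> newton_step P \<epsilon> S (\<theta>s ! t) (\<theta>s ! Suc t)) \<and>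
     (\<forall>\<theta>\<in>feasible_params P. loss P S (last \<theta>s) \<le> loss P S \<theta> + \<epsilon>)"

definition newton_solver ::
  "('i, 'j, 'f) problem \<Rightarrow> real \<Rightarrow> ('i set \<Rightarrow> ('j, 'f) param list) \<Rightarrow> bool" where
  "newton_solver P \<epsilon> run \<longleftrightarrow>
     (\<forall>S\<subseteq>obs P. min_leaf P \<le> card S \<longrightarrow> newton_run P \<epsilon> S (run S))"

definition newton_fit ::
  "('i, 'j, 'f) problem \<Rightarrow> ('i set \<Rightarrow> ('j, 'f) param list) \<Rightarrow> 'i set \<Rightarrow> real \<times> ('j, 'f) param"
where
  "newton_fit P run S =
     (loss P S (last (run S)) + penalty P * real (n_params P), last (run S))"

definition n_iterations :: "'p list \<Rightarrow> nat" where
  "n_iterations \<theta>s = length \<theta>s - 1"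

definition newton_time ::
  "('i, 'j, 'f) problem \<Rightarrow> cost_model \<Rightarrow> real \<Rightarrow> ('i set \<Rightarrow> ('j, 'f) param list) \<Rightarrow> 'i set \<Rightarrow> real"
where
  "newton_time P C \<epsilon> run S = real (n_iterations (run S)) *
     (deriv_cost C (card S) (n_params P) + con_cost C (n_cons P) (n_params P) +
      qp_cost C (n_params P) (n_cons P) \<epsilon>)"

definition max_newton ::
  "('i, 'j, 'f) problem \<Rightarrow> ('i set \<Rightarrow> ('j, 'f) param list) \<Rightarrow> nat \<Rightarrow> nat" where
  "max_newton P run n =
     Max ((\<lambda>S. n_iterations (run S)) ` {S. S \<subseteq> obs P \<and> min_leaf P \<le> card S \<and> card S \<le> n})"

definition time_bound ::
  "('i, 'j, 'f) problem \<Rightarrow> cost_model \<Rightarrow> real \<Rightarrow> ('i set \<Rightarrow> ('j, 'f) param list) \<Rightarrow> real" where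
  "time_bound P C \<epsilon> run =
    (let N = card (obs P); N0 = n_params P; m = n_cons P; F' = set (cands P) in
     (\<Sum>d=0..max_depth P. real (card F' choose d) * 2 ^ d) *
     (real (max_newton P run N) *
        (real N * (real N0)\<^sup>2 + real m * real N0 + qp_cost C N0 m \<epsilon>) +
      real (card F') * real N))"

end

theory Submission
  imports Defs
begin

text \<open>
  Both claims rest on one invariant of the memo (\<open>consistent\<close>): every cached entry satisfies the
  Bellman equation of its state with respect to the other cached entries. Its value is at most the
  leaf value and at most the sum of the two cached child values for every admissible split, and the
  cached action attains it. Entries are never overwritten, so an equation that holds when its entry
  is stored holds for ever, and no separate description of the value function is needed.

  Optimality. Following the cached actions from the root gives a tree whose leaf values add up to
  the cached root value (\<open>backtrack_spec\<close>). Conversely the inequalities, chained down any competing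
  feasible tree, show that the root value is at most its objective (\<open>cached_value_le\<close>). A split of
  a feasible tree is always admissible, because each side contains a leaf and hence at
  least \<open>min_leaf\<close> observations.

  Running time. A state at depth $d$ is an index set cut out by the values of $d$ candidates. The
  candidates on a path are distinct, since splitting twice on the same one leaves an empty side, and
  the set does not depend on their order. So there are at most $\binom{|F'|}{d} 2^d$ states at
  depth $d$ (\<open>card_states_le\<close>), where $F'$ is the set of candidates. Depth grows along recursive
  calls, so a state is expanded only
  once; it pays for one leaf fit and for the partition by each candidate, and this payment is charged
  to its cache entry (\<open>extends\<close>). The nodes visited while the tree is recovered are distinct states
  and are charged in the same way (\<open>backtrack_spec\<close>). It remains to bound the charge of one state by
  the bracket in the asymptotic formula, with a constant that depends on the cost model only
  (\<open>running_time_le_time_bound\<close>).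
\<close>

section \<open>Reachable states\<close>

text \<open>
  \<open>A\<close> is the set of candidates on the path to the state and \<open>B\<close> the set of those whose value on the
  path is $1$. Sets replace paths because the order of the splits must not be counted.
\<close>

definition cell ::
  "('i, 'j, 'f) problem \<Rightarrow> 'f candidate set \<Rightarrow> 'f candidate set \<Rightarrow> 'i set" where
  "cell P A B = {i \<in> obs P. \<forall>f\<in>A. f (features P i) \<longleftrightarrow> f \<in> B}"

definition states :: "('i, 'j, 'f) problem \<Rightarrow> ('i set \<times> nat) set" where
  "states P = {(S, d). min_leaf P \<le> card S \<and> d \<le> max_depth P \<and>
     (\<exists>A B. A \<subseteq> set (cands P) \<and> card A = d \<and> B \<subseteq> A \<and> S = cell P A B)}"

lemma states_subset_obs: "(S, d) \<in> states P \<Longrightarrow> S \<subseteq> obs P"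
  by (auto simp: states_def cell_def)

lemma states_min_leaf: "(S, d) \<in> states P \<Longrightarrow> min_leaf P \<le> card S"
  by (auto simp: states_def)

lemma states_max_depth: "(S, d) \<in> states P \<Longrightarrow> d \<le> max_depth P"
  by (auto simp: states_def)

lemma root_state: "min_leaf P \<le> card (obs P) \<Longrightarrow> (obs P, 0) \<in> states P"
  unfolding states_def cell_def by (auto intro!: exI[of _ "{}"])

lemma branch_subset: "branch P S f b \<subseteq> S"
  by (auto simp: branch_def)

lemma branches_disjoint: "branch P S f False \<inter> branch P S f True = {}"
  by (auto simp: branch_def)

text \<open>
  Both sides of an admissible split are nonempty, so the candidate is not yet among those that
  define the state; this is why each level adds exactly one new candidate.
\<close>

lemma branch_state:
  assumes "1 \<le> min_leaf P" "(S, d) \<in> states P" "f \<in> admissible P S d"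
  shows "(branch P S f b, Suc d) \<in> states P"
proof -
  obtain A B where AB: "A \<subseteq> set (cands P)" "card A = d" "B \<subseteq> A" "S = cell P A B"
    using assms(2) by (auto simp: states_def)
  have f: "d < max_depth P" "f \<in> set (cands P)"
      "min_leaf P \<le> card (branch P S f False)" "min_leaf P \<le> card (branch P S f True)"
    using assms(3) by (auto simp: admissible_def split: if_splits)
  have "branch P S f c \<noteq> {}" for c
    using f(3,4) assms(1) by (cases c) auto
  from this[of False] this[of True] have "f \<notin> A"
    by (auto simp: branch_def AB(4) cell_def)
  have "finite A"
    using AB(1) finite_subset by blast
  define B' where "B' = (if b then insert f B else B)"
  have "branch P S f b = cell P (insert f A) B'"
  proof (cases b)
    case True
    have "g \<in> insert f B \<longleftrightarrow> g \<in> B" if "g \<in> A" for g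
      using that \<open>f \<notin> A\<close> by auto
    then show ?thesis
      using True by (auto simp: branch_def AB(4) cell_def B'_def)
  next
    case False
    then show ?thesis
      using \<open>f \<notin> A\<close> AB(3) by (auto simp: branch_def AB(4) cell_def B'_def)
  qed
  moreover have "insert f A \<subseteq> set (cands P)" "card (insert f A) = Suc d" "B' \<subseteq> insert f A"
    using \<open>f \<notin> A\<close> \<open>finite A\<close> AB f by (auto simp: B'_def)
  moreover have "min_leaf P \<le> card (branch P S f b)"
    using f by (cases b) auto
  ultimately show ?thesis
    using f(1) unfolding states_def mem_Collect_eq prod.case Suc_le_eq by blast
qed

text \<open>
  A state at depth $d$ is the image of a pair \<open>(A, B)\<close> with $|A| = d$ and $B \subseteq A$. Different
  pairs may give the same state, which only helps.
\<close>

lemma finite_states_and_card_le: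
  shows finite_states: "finite (states P)"
    and card_states_le:
      "card (states P) \<le> (\<Sum>d=0..max_depth P. (card (set (cands P)) choose d) * 2 ^ d)"
proof -
  define labels where "labels d = (SIGMA A:{A. A \<subseteq> set (cands P) \<and> card A = d}. Pow A)" for d
  have fin_A: "finite A" if "A \<subseteq> set (cands P)" for A
    using that by (rule finite_subset) simp
  have fin_index: "finite {A. A \<subseteq> set (cands P) \<and> card A = d}" for d
    by (rule finite_subset[of _ "Pow (set (cands P))"]) auto
  have fin: "finite (labels d)" for d
    unfolding labels_def by (rule finite_SigmaI[OF fin_index]) (simp add: fin_A)
  have "card (labels d) = (\<Sum>A | A \<subseteq> set (cands P) \<and> card A = d. card (Pow A))" for d
    unfolding labels_def by (rule card_SigmaI[OF fin_index]) (simp add: fin_A)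
  then have card_labels: "card (labels d) = (card (set (cands P)) choose d) * 2 ^ d" for d
    by (simp add: n_subsets card_Pow fin_A)
  let ?L = "SIGMA d:{0..max_depth P}. labels d"
  have sub: "states P \<subseteq> (\<lambda>(d, A, B). (cell P A B, d)) ` ?L"
  proof
    fix x assume "x \<in> states P"
    then obtain A B where "card A \<le> max_depth P" "A \<subseteq> set (cands P)" "B \<subseteq> A"
        "x = (cell P A B, card A)"
      by (auto simp: states_def)
    then show "x \<in> (\<lambda>(d, A, B). (cell P A B, d)) ` ?L"
      by (intro image_eqI[of _ _ "(card A, A, B)"]) (auto simp: labels_def)
  qed
  have finL: "finite ?L"
    by (intro finite_SigmaI fin) simp
  show "finite (states P)"
    using finite_subset[OF sub] finL by blast
  have "card (states P) \<le> card ?L"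
    using surj_card_le[OF finL sub] .
  also have "\<dots> = (\<Sum>d=0..max_depth P. (card (set (cands P)) choose d) * 2 ^ d)"
    using fin by (simp add: card_SigmaI card_labels)
  finally show "card (states P) \<le> (\<Sum>d=0..max_depth P. (card (set (cands P)) choose d) * 2 ^ d)" .
qed


section \<open>The invariant of the recursion\<close>

text \<open>
  As a rewrite rule the equation of \<open>backtrack\<close> would unfold for ever, and that of \<open>solve_state\<close> would
  expand the recursive calls inside the loop, where their specification is wanted.
\<close>

declare solve_state.simps [simp del] backtrack.simps [simp del]

text \<open>
  The leaf fit is arbitrary here: the invariant and the time bound hold for an inexact solver too.
\<close>

locale tree_dp =
  fixes P :: "('i, 'j, 'f) problem" and C :: cost_model
    and fit :: "'i set \<Rightarrow> real \<times> 'p" and tm :: "'i set \<Rightarrow> real"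
  assumes valid: "valid_problem P" and costs: "valid_cost_model C"
begin

lemma min_leaf_pos: "1 \<le> min_leaf P"
  using valid by (simp add: valid_problem_def)

lemma step_cost_nonneg: "0 \<le> step_cost C"
  using costs by (simp add: valid_cost_model_def)

lemma part_cost_nonneg: "0 \<le> part_cost C n"
  using costs by (simp add: valid_cost_model_def)

text \<open>
  A relation rather than a function, so that it asserts that both children are cached and is
  monotone in the cache.
\<close>

definition split_value ::
  "('i, 'f candidate, 'p) memo \<Rightarrow> 'i set \<Rightarrow> nat \<Rightarrow> 'f candidate \<Rightarrow> ereal \<Rightarrow> bool" where
  "split_value m S d f w \<longleftrightarrow> (\<exists>v0 a0 v1 a1.
     state_cache m (branch P S f False, Suc d) = Some (v0, a0) \<and>
     state_cache m (branch P S f True, Suc d) = Some (v1, a1) \<and> w = v0 + v1)"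

definition bellman ::
  "('i, 'f candidate, 'p) memo \<Rightarrow> 'i set \<Rightarrow> nat \<Rightarrow> ereal \<Rightarrow> 'f candidate action option \<Rightarrow> bool"
where
  "bellman m S d v a \<longleftrightarrow> v \<le> ereal (fst (fit S)) \<and>
     (\<forall>f\<in>admissible P S d. \<exists>w. split_value m S d f w \<and> v \<le> w) \<and>
     (case a of None \<Rightarrow> False
      | Some Fit_Leaf \<Rightarrow> v = ereal (fst (fit S))
      | Some (Split_On f) \<Rightarrow> f \<in> admissible P S d \<and> split_value m S d f v)"

definition consistent :: "('i, 'f candidate, 'p) memo \<Rightarrow> bool" where
  "consistent m \<longleftrightarrow>
     (\<forall>S h\<theta>. fit_cache m S = Some h\<theta> \<longrightarrow> h\<theta> = fit S) \<and>
     (\<forall>S d v a. state_cache m (S, d) = Some (v, a) \<longrightarrow>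
        (S, d) \<in> states P \<and> fit_cache m S \<noteq> None \<and> bellman m S d v a)"

text \<open>
  The absolute value of \<open>tm S\<close> makes the charge nonnegative for every time function, so that
  the invariant can be used in the optimality proof, where \<open>tm\<close> is arbitrary.
\<close>

definition state_cost :: "'i set \<Rightarrow> real" where
  "state_cost S = step_cost C + \<bar>tm S\<bar> +
     real (length (cands P)) * (step_cost C + part_cost C (card S))"

text \<open>
  The effect of a computation on the memo. The time spent is amortised: it is charged to the newly
  cached states, up to a remainder \<open>b\<close> which the loop over the candidates still owes to the state
  whose expansion is in progress. The depth \<open>d\<close> bounds the new states from below; it is what shows
  that the recursive calls never cache the state that is being expanded.
\<close>

definition extends ::
  "nat \<Rightarrow> real \<Rightarrow> ('i, 'f candidate, 'p) memo \<Rightarrow> ('i, 'f candidate, 'p) memo \<Rightarrow> bool" where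
  "extends d b m m' \<longleftrightarrow> state_cache m \<subseteq>\<^sub>m state_cache m' \<and> fit_cache m \<subseteq>\<^sub>m fit_cache m' \<and>
     (\<forall>(S, e) \<in> dom (state_cache m') - dom (state_cache m). d \<le> e) \<and>
     \<bar>clock m' - clock m\<bar> \<le>
       b + (\<Sum>(S, e) \<in> dom (state_cache m') - dom (state_cache m). state_cost S)"

lemma split_value_mono:
  "split_value m S d f w \<Longrightarrow> state_cache m \<subseteq>\<^sub>m state_cache m' \<Longrightarrow> split_value m' S d f w"
  unfolding split_value_def map_le_def by (metis domI)

lemma bellman_mono:
  "bellman m S d v a \<Longrightarrow> state_cache m \<subseteq>\<^sub>m state_cache m' \<Longrightarrow> bellman m' S d v a"
  unfolding bellman_def using split_value_mono[of m S d _ _ m']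
  by (intro conjI; (blast | simp split: option.splits action.splits))

lemma consistent_finite_dom: "consistent m \<Longrightarrow> finite (dom (state_cache m))"
  by (rule finite_subset[OF _ finite_states[of P]]) (auto simp: consistent_def)

lemma consistent_fit_cache: "consistent m \<Longrightarrow> fit_cache m S = Some h\<theta> \<Longrightarrow> h\<theta> = fit S"
  unfolding consistent_def by blast

lemma consistent_fit: "consistent m \<Longrightarrow> state_cache m (S, d) = Some va \<Longrightarrow> fit_cache m S = Some (fit S)"
  unfolding consistent_def by (metis not_None_eq surj_pair)

lemma consistent_cong:
  assumes "state_cache m' = state_cache m" "fit_cache m' = fit_cache m"
  shows "consistent m' \<longleftrightarrow> consistent m"
  unfolding consistent_def bellman_def split_value_def assms ..

lemma extends_refl: "extends d 0 m m"
  by (simp add: extends_def)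

lemma extends_clock:
  assumes "state_cache m' = state_cache m" "fit_cache m' = fit_cache m" "\<bar>clock m' - clock m\<bar> \<le> b"
  shows "extends d b m m'"
  using assms by (simp add: extends_def)

lemma extends_trans:
  assumes "extends d b m m'" "extends d b' m' m''" "finite (dom (state_cache m''))"
  shows "extends d (b + b') m m''"
proof -
  let ?D = "dom (state_cache m)" and ?D' = "dom (state_cache m')" and ?D'' = "dom (state_cache m'')"
  have sub: "?D \<subseteq> ?D'" "?D' \<subseteq> ?D''"
    using assms(1,2) by (auto simp: extends_def dest: map_le_implies_dom_le)
  have eq: "?D'' - ?D = (?D' - ?D) \<union> (?D'' - ?D')"
    using sub by auto
  have "(\<Sum>(S, e)\<in>?D'' - ?D. state_cost S) =
      (\<Sum>(S, e)\<in>?D' - ?D. state_cost S) + (\<Sum>(S, e)\<in>?D'' - ?D'. state_cost S)"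
    unfolding eq using assms(3) sub by (intro sum.union_disjoint) (auto intro: finite_subset)
  moreover have "\<forall>(S, e) \<in> ?D'' - ?D. d \<le> e"
    unfolding eq using assms(1,2) by (auto simp: extends_def)
  ultimately show ?thesis
    using assms(1,2) unfolding extends_def by (auto intro: map_le_trans)
qed

definition solves :: "'i set \<Rightarrow> nat \<Rightarrow> bool" where
  "solves S d \<longleftrightarrow> (\<forall>m v m'. consistent m \<longrightarrow> solve_state P C fit tm S d m = (v, m') \<longrightarrow>
     consistent m' \<and> extends d 0 m m' \<and> (\<exists>a. state_cache m' (S, d) = Some (v, a)))"

text \<open>
  The incumbent only decreases, so a split value that it has been compared with stays an upper bound
  for it. The last conjunct says that the final incumbent is the initial one or the value of a split
  whose children are cached. The \<open>if\<close> of the loop is moved into the incumbent (\<open>vn\<close>, \<open>an\<close>), which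
  merges the improving and the non-improving case.
\<close>

lemma try_cands_spec:
  assumes "\<And>f b. f \<in> admissible P S d \<Longrightarrow> solves (branch P S f b) (Suc d)"
    and "consistent m" "try_cands P C fit tm S d fs v a m = (v', a', m')"
  shows "consistent m' \<and>
    extends (Suc d) (real (length fs) * (step_cost C + part_cost C (card S))) m m' \<and> v' \<le> v \<and>
    (\<forall>f \<in> set fs \<inter> admissible P S d. \<exists>w. split_value m' S d f w \<and> v' \<le> w) \<and>
    ((a', v') = (a, v) \<or>
      (\<exists>f\<in>admissible P S d. a' = Split_On f \<and> split_value m' S d f v'))"
  using assms(2,3)
proof (induction fs arbitrary: v a m)
  case Nil
  then show ?case by (auto simp: extends_refl)
next
  case (Cons f fs)
  let ?c = "step_cost C + part_cost C (card S)"
  define m1 where "m1 = charge ?c m"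
  have m1: "consistent m1" "extends (Suc d) ?c m m1"
    using Cons.prems(1) step_cost_nonneg part_cost_nonneg[of "card S"]
    by (auto simp: m1_def charge_def intro!: extends_clock cong: consistent_cong)
  show ?case
  proof (cases "f \<in> admissible P S d")
    case False
    then have "try_cands P C fit tm S d fs v a m1 = (v', a', m')"
      using Cons.prems(2) by (simp add: m1_def Let_def)
    note IH = Cons.IH[OF m1(1) this]
    then have "extends (Suc d) (?c + real (length fs) * ?c) m m'"
      using m1 by (blast intro: extends_trans consistent_finite_dom)
    with IH False show ?thesis
      by (auto simp: algebra_simps)
  next
    case True
    obtain v0 m2 where s0: "solve_state P C fit tm (branch P S f False) (Suc d) m1 = (v0, m2)"
      by force
    obtain v1 m3 where s1: "solve_state P C fit tm (branch P S f True) (Suc d) m2 = (v1, m3)"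
      by force
    have m2: "consistent m2" "extends (Suc d) 0 m1 m2"
        "\<exists>a0. state_cache m2 (branch P S f False, Suc d) = Some (v0, a0)"
      using assms(1)[OF True, of False] m1(1) s0 unfolding solves_def by blast+
    have m3: "consistent m3" "extends (Suc d) 0 m2 m3"
        "\<exists>a1. state_cache m3 (branch P S f True, Suc d) = Some (v1, a1)"
      using assms(1)[OF True, of True] m2(1) s1 unfolding solves_def by blast+
    have "extends (Suc d) (?c + 0) m m2"
      using m1 m2 by (blast intro: extends_trans consistent_finite_dom)
    then have "extends (Suc d) (?c + 0 + 0) m m3"
      using m3 by (blast intro: extends_trans consistent_finite_dom)
    then have e3: "extends (Suc d) ?c m m3"
      by simp
    have "state_cache m2 \<subseteq>\<^sub>m state_cache m3"
      using m3(2) by (simp add: extends_def)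
    then have sv: "split_value m3 S d f (v0 + v1)"
      unfolding split_value_def using m2(3) m3(3) by (metis domI map_le_def)
    define vn where "vn = (if v0 + v1 < v then v0 + v1 else v)"
    define an where "an = (if v0 + v1 < v then Split_On f else a)"
    have "try_cands P C fit tm S d fs vn an m3 = (v', a', m')"
      using Cons.prems(2) True s0 s1 by (simp add: m1_def Let_def vn_def an_def split: if_splits)
    note IH = Cons.IH[OF m3(1) this]
    have "extends (Suc d) (?c + real (length fs) * ?c) m m'"
      using e3 IH by (blast intro: extends_trans consistent_finite_dom)
    moreover have "split_value m' S d f (v0 + v1)"
      using sv IH by (auto simp: extends_def intro: split_value_mono)
    moreover have "vn \<le> v" "vn \<le> v0 + v1"
      by (auto simp: vn_def)
    moreover have "(an, vn) = (a, v) \<or> an = Split_On f \<and> vn = v0 + v1"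
      by (auto simp: vn_def an_def)
    ultimately show ?thesis
      using IH True by (auto simp: algebra_simps intro: order_trans)
  qed
qed

text \<open>
  Induction on the remaining depth. The loop debt of \<open>try_cands_spec\<close>, the leaf fit and the unit step
  are covered by the charge of the state itself, which is paid when its entry is stored; the entry is
  new because the recursive calls cache deeper states only.
\<close>

lemma solve_state_spec: "(S, d) \<in> states P \<Longrightarrow> solves S d"
proof (induction "max_depth P - d" arbitrary: S d rule: less_induct)
  case less
  have sub: "solves (branch P S f b) (Suc d)" if "f \<in> admissible P S d" for f b
  proof (rule less.hyps)
    show "max_depth P - Suc d < max_depth P - d"
      using that by (auto simp: admissible_def split: if_splits)
    show "(branch P S f b, Suc d) \<in> states P"
      using branch_state[OF min_leaf_pos less.prems that] .
  qed
  show ?case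
    unfolding solves_def
  proof (intro allI impI)
    fix m v m'
    assume cons: "consistent m" and run: "solve_state P C fit tm S d m = (v, m')"
    show "consistent m' \<and> extends d 0 m m' \<and> (\<exists>a. state_cache m' (S, d) = Some (v, a))"
    proof (cases "state_cache m (S, d)")
      case (Some va)
      then have "m' = m" "v = fst va"
        using run by (auto simp: solve_state.simps split: prod.splits)
      then show ?thesis
        using cons Some by (cases va) (auto simp: extends_refl)
    next
      case None
      let ?c = "step_cost C + part_cost C (card S)"
      let ?b = "real (length (cands P)) * ?c"
      define m1 where "m1 = charge (step_cost C) m"
      obtain h\<theta> m2 where g: "get_fit fit tm S m1 = (h\<theta>, m2)"
        by (metis surj_pair)
      have eq2: "state_cache m2 = state_cache m" "fit_cache m2 = fit_cache m"
        "\<bar>clock m2 - clock m\<bar> \<le> step_cost C + \<bar>tm S\<bar>"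
        using g step_cost_nonneg
        by (auto simp: get_fit_def m1_def charge_def split: option.splits)
      have h: "h\<theta> = fit S"
        using g consistent_fit_cache[OF cons, of S] by (auto simp: get_fit_def m1_def charge_def split: option.splits)
      have cons2: "consistent m2"
        using consistent_cong[OF eq2(1,2)] cons by simp
      obtain v3 a3 m3 where t: "(if d < max_depth P
          then try_cands P C fit tm S d (cands P) (ereal (fst h\<theta>)) Fit_Leaf m2
          else (ereal (fst h\<theta>), Fit_Leaf, m2)) = (v3, a3, m3)"
        using prod_cases3 by blast
      have m': "v = v3" "m' = store_fit S (fit S) (store_state S d (v, Some a3) m3)"
        using run None states_min_leaf[OF less.prems] g t[unfolded h]
        by (auto simp: solve_state.simps m1_def[symmetric] Let_def h)
      have b: "0 \<le> ?b"
        using step_cost_nonneg part_cost_nonneg by simp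
      have spec: "consistent m3 \<and> extends (Suc d) ?b m2 m3 \<and> v3 \<le> ereal (fst h\<theta>) \<and>
        (\<forall>f \<in> admissible P S d. \<exists>w. split_value m3 S d f w \<and> v3 \<le> w) \<and>
        ((a3, v3) = (Fit_Leaf, ereal (fst h\<theta>)) \<or>
          (\<exists>f\<in>admissible P S d. a3 = Split_On f \<and> split_value m3 S d f v3))"
      proof (cases "d < max_depth P")
        case True
        have "set (cands P) \<inter> admissible P S d = admissible P S d"
          by (auto simp: admissible_def)
        then show ?thesis
          using try_cands_spec[OF sub cons2, of "cands P" "ereal (fst h\<theta>)" Fit_Leaf v3 a3 m3] t True
          by simp
      next
        case False
        then have "admissible P S d = {}" "m3 = m2" "v3 = ereal (fst h\<theta>)" "a3 = Fit_Leaf"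
          using t by (auto simp: admissible_def)
        then show ?thesis
          using cons2 b by (simp add: extends_clock)
      qed
      have e3: "extends (Suc d) ?b m2 m3"
        using spec by (elim conjE)
      then have deeper: "Suc d \<le> e"
        if "(T, e) \<in> dom (state_cache m3) - dom (state_cache m)" for T e
        using that unfolding extends_def eq2(1) by blast
      have fresh: "state_cache m3 (S, d) = None"
      proof (rule ccontr)
        assume "state_cache m3 (S, d) \<noteq> None"
        then have "(S, d) \<in> dom (state_cache m3) - dom (state_cache m)"
          using None by auto
        then show False
          using deeper[of S d] by simp
      qed
      have sc: "state_cache m' = (state_cache m3)((S, d) \<mapsto> (v, Some a3))"
        and fc: "fit_cache m' = (fit_cache m3)(S \<mapsto> fit S)" and ck: "clock m' = clock m3"
        by (simp_all add: m'(2) store_fit_def store_state_def)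
      have le: "state_cache m3 \<subseteq>\<^sub>m state_cache m'"
        using fresh by (auto simp: sc map_le_def)
      have "bellman m3 S d v (Some a3)"
        unfolding bellman_def m'(1) using spec[unfolded h] by (elim conjE disjE) auto
      then have bell: "bellman m' S d v (Some a3)"
        using bellman_mono le by blast
      have cons3: "consistent m3"
        using spec by simp
      have cons': "consistent m'"
        unfolding consistent_def
      proof (intro conjI allI impI)
        fix T h\<theta>'
        assume "fit_cache m' T = Some h\<theta>'"
        then show "h\<theta>' = fit T"
          using consistent_fit_cache[OF cons3, of T] by (simp add: fc split: if_splits)
      next
        fix T e u c
        assume *: "state_cache m' (T, e) = Some (u, c)"
        have "(T, e) \<in> states P \<and> fit_cache m' T \<noteq> None \<and> bellman m' T e u c"
        proof (cases "(T, e) = (S, d)")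
          case True
          then show ?thesis
            using * less.prems bell by (auto simp: sc fc)
        next
          case False
          then have "state_cache m3 (T, e) = Some (u, c)"
            using * by (auto simp: sc split: if_splits)
          then have "(T, e) \<in> states P" "fit_cache m3 T \<noteq> None" "bellman m3 T e u c"
            using cons3 unfolding consistent_def by blast+
          then show ?thesis
            using bellman_mono[OF _ le] by (auto simp: fc)
        qed
        then show "(T, e) \<in> states P" "fit_cache m' T \<noteq> None" "bellman m' T e u c"
          by blast+
      qed
      let ?new = "dom (state_cache m3) - dom (state_cache m)"
      have new': "dom (state_cache m') - dom (state_cache m) = insert (S, d) ?new"
        using None by (auto simp: sc)
      have sum': "(\<Sum>(S, e)\<in>insert (S, d) ?new. state_cost S) =
          state_cost S + (\<Sum>(S, e)\<in>?new. state_cost S)"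
        using fresh consistent_finite_dom[OF cons3] by (subst sum.insert) auto
      have "\<bar>clock m3 - clock m2\<bar> \<le> ?b + (\<Sum>(S, e)\<in>?new. state_cost S)"
        using e3 by (simp add: extends_def eq2(1))
      then have "\<bar>clock m' - clock m\<bar> \<le> state_cost S + (\<Sum>(S, e)\<in>?new. state_cost S)"
        using eq2(3) unfolding ck state_cost_def by linarith
      moreover have "state_cache m \<subseteq>\<^sub>m state_cache m'"
        using e3 le map_le_trans unfolding extends_def eq2(1) by blast
      moreover have "fit_cache m \<subseteq>\<^sub>m fit_cache m'"
      proof -
        have "fit_cache m \<subseteq>\<^sub>m fit_cache m3"
          using e3 unfolding extends_def eq2(2) by blast
        then have "fit_cache m' T = Some h" if "fit_cache m T = Some h" for T h
          using that consistent_fit_cache[OF cons that] unfolding fc map_le_def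
          by (metis domI fun_upd_apply)
        then show ?thesis
          unfolding map_le_def dom_def by force
      qed
      moreover have "\<forall>(S, e) \<in> insert (S, d) ?new. d \<le> e"
        using deeper by (auto dest: Suc_leD)
      ultimately have "extends d 0 m m'"
        unfolding extends_def new' sum' by simp
      then show ?thesis
        using cons' by (simp add: sc)
    qed
  qed
qed

lemma final_memo:
  assumes "solve_state P C fit tm (obs P) 0 empty_memo = (v, m)"
  shows "consistent m" "\<exists>a. state_cache m (obs P, 0) = Some (v, a)"
    and "\<bar>clock m\<bar> \<le> (\<Sum>(S, e)\<in>states P. state_cost S)"
proof -
  have "consistent empty_memo"
    by (simp add: consistent_def empty_memo_def)
  moreover have "(obs P, 0) \<in> states P"
    using valid by (auto simp: valid_problem_def intro: root_state)
  ultimately have *: "consistent m \<and> extends 0 0 empty_memo m \<and>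
      (\<exists>a. state_cache m (obs P, 0) = Some (v, a))"
    using solve_state_spec assms unfolding solves_def by blast
  then show "consistent m" "\<exists>a. state_cache m (obs P, 0) = Some (v, a)"
    by auto
  have "\<bar>clock m\<bar> \<le> (\<Sum>(S, e)\<in>dom (state_cache m). state_cost S)"
    using * by (auto simp: extends_def empty_memo_def)
  also have "\<dots> \<le> (\<Sum>(S, e)\<in>states P. state_cost S)"
    using * finite_states step_cost_nonneg part_cost_nonneg
    by (intro sum_mono2) (auto simp: consistent_def state_cost_def)
  finally show "\<bar>clock m\<bar> \<le> (\<Sum>(S, e)\<in>states P. state_cost S)" .
qed


section \<open>Recovery of the tree\<close>

definition node_cost :: "'i set \<Rightarrow> real" where
  "node_cost S = step_cost C + part_cost C (card S)"

text \<open>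
  An upper bound for the states that the recovered subtree below \<open>(S, d)\<close> can visit, chosen so that
  the bounds of the two children are disjoint.
\<close>

definition descendants :: "'i set \<Rightarrow> nat \<Rightarrow> ('i set \<times> nat) set" where
  "descendants S d = {(T, e) \<in> states P. T \<subseteq> S \<and> d \<le> e}"

lemma node_cost_nonneg: "0 \<le> node_cost S"
  using step_cost_nonneg part_cost_nonneg by (simp add: node_cost_def)

text \<open>
  The index set of a state is nonempty, so no state is contained in both sides of a split.
\<close>

lemma descendants_cost_split:
  assumes "(S, d) \<in> states P"
  shows "node_cost S + (\<Sum>(T, e)\<in>descendants (branch P S f False) (Suc d). node_cost T) +
      (\<Sum>(T, e)\<in>descendants (branch P S f True) (Suc d). node_cost T)
    \<le> (\<Sum>(T, e)\<in>descendants S d. node_cost T)"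
proof -
  let ?A = "descendants (branch P S f False) (Suc d)"
  let ?B = "descendants (branch P S f True) (Suc d)"
  have fin: "finite (descendants T e)" for T e
    by (rule finite_subset[OF _ finite_states[of P]]) (auto simp: descendants_def)
  have nonempty: "T \<noteq> {}" if "(T, e) \<in> states P" for T e
    using states_min_leaf[OF that] min_leaf_pos by auto
  have disj: "?A \<inter> ?B = {}"
    using nonempty branches_disjoint[of P S f] unfolding descendants_def by blast
  have "(S, d) \<notin> ?A \<union> ?B"
    by (auto simp: descendants_def)
  then have "node_cost S + (\<Sum>(T, e)\<in>?A. node_cost T) + (\<Sum>(T, e)\<in>?B. node_cost T) =
      (\<Sum>(T, e)\<in>insert (S, d) (?A \<union> ?B). node_cost T)"
    using fin disj by (simp add: sum.union_disjoint)
  also have "\<dots> \<le> (\<Sum>(T, e)\<in>descendants S d. node_cost T)"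
  proof (intro sum_mono2 fin)
    show "insert (S, d) (?A \<union> ?B) \<subseteq> descendants S d"
      using assms branch_subset[of P S f] by (fastforce simp: descendants_def)
  qed (auto simp: node_cost_nonneg)
  finally show ?thesis .
qed

text \<open>
  The Bellman equation says that the value of a cached entry is attained by its action, and that the
  children of its split are cached; hence the recovery is defined everywhere below \<open>(S, d)\<close>, and the
  value unfolds into the values of the fits at the leaves.
\<close>

lemma backtrack_spec:
  assumes "consistent m" "state_cache m (S, d) = Some (v, a)" "backtrack P C m S d = (t, \<tau>)"
  shows "d + depth t \<le> max_depth P \<and> splits t \<subseteq> set (cands P) \<and>
    (\<forall>(L, \<theta>) \<in> set (leaves P t S). L \<subseteq> obs P \<and> min_leaf P \<le> card L \<and> \<theta> = snd (fit L)) \<and>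
    v = ereal (\<Sum>(L, \<theta>)\<leftarrow>leaves P t S. fst (fit L)) \<and>
    \<bar>\<tau>\<bar> \<le> (\<Sum>(T, e)\<in>descendants S d. node_cost T)"
  using assms(2,3)
proof (induction "max_depth P - d" arbitrary: S d v a t \<tau> rule: less_induct)
  case less
  have st: "(S, d) \<in> states P" and bell: "bellman m S d v a"
    using assms(1) less.prems(1) by (auto simp: consistent_def)
  show ?case
  proof (cases a)
    case None
    then show ?thesis
      using bell by (simp add: bellman_def)
  next
    case (Some act)
    show ?thesis
    proof (cases act)
      case Fit_Leaf
      have "v = ereal (fst (fit S))" "t = Leaf (snd (fit S))" "\<tau> = step_cost C"
        using less.prems bell Some Fit_Leaf consistent_fit[OF assms(1) less.prems(1)]
        by (auto simp: bellman_def backtrack.simps[of P C m S d])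
      moreover have "\<bar>step_cost C\<bar> \<le> (\<Sum>(T, e)\<in>descendants S d. node_cost T)"
      proof -
        have "\<bar>step_cost C\<bar> \<le> node_cost S"
          using step_cost_nonneg part_cost_nonneg[of "card S"] by (simp add: node_cost_def)
        moreover have "0 \<le> (\<Sum>(T, e)\<in>D. node_cost T)" for D :: "('i set \<times> nat) set"
          by (intro sum_nonneg) (auto simp: node_cost_nonneg)
        ultimately show ?thesis
          using descendants_cost_split[OF st, of undefined] by (meson add_increasing2 order_trans)
      qed
      ultimately show ?thesis
        using states_subset_obs[OF st] states_min_leaf[OF st] states_max_depth[OF st] by auto
    next
      case (Split_On f)
      have f: "f \<in> admissible P S d" "split_value m S d f v"
        using bell Some Split_On by (auto simp: bellman_def)
      then have d: "d < max_depth P" "f \<in> set (cands P)"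
        by (auto simp: admissible_def split: if_splits)
      obtain v0 a0 v1 a1 where v:
        "state_cache m (branch P S f False, Suc d) = Some (v0, a0)"
        "state_cache m (branch P S f True, Suc d) = Some (v1, a1)" "v = v0 + v1"
        using f(2) by (auto simp: split_value_def)
      obtain l tl where l: "backtrack P C m (branch P S f False) (Suc d) = (l, tl)"
        by force
      obtain r tr where r: "backtrack P C m (branch P S f True) (Suc d) = (r, tr)"
        by force
      have t: "t = Node f l r" "\<tau> = node_cost S + tl + tr"
        using less.prems Some Split_On d(1) l r
        by (auto simp: backtrack.simps[of P C m S d] node_cost_def)
      have lt: "max_depth P - Suc d < max_depth P - d"
        using d by simp
      note IHl = less.hyps[OF lt v(1) l] and IHr = less.hyps[OF lt v(2) r]
      have "\<bar>\<tau>\<bar> \<le> (\<Sum>(T, e)\<in>descendants S d. node_cost T)"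
        using descendants_cost_split[OF st, of f] IHl IHr node_cost_nonneg[of S]
        unfolding t(2) by linarith
      then show ?thesis
        using IHl IHr d v(3) unfolding t(1) by auto
    qed
  qed
qed

lemma running_time_le:
  "\<bar>running_time P C fit tm\<bar> \<le> (\<Sum>(S, e)\<in>states P. state_cost S + node_cost S)"
proof -
  obtain v m where s: "solve_state P C fit tm (obs P) 0 empty_memo = (v, m)"
    by force
  obtain t \<tau> where b: "backtrack P C m (obs P) 0 = (t, \<tau>)"
    by force
  obtain a where a: "state_cache m (obs P, 0) = Some (v, a)"
    using final_memo(2)[OF s] by blast
  have "descendants (obs P) 0 = states P"
    by (auto simp: descendants_def dest: states_subset_obs)
  then have "\<bar>\<tau>\<bar> \<le> (\<Sum>(S, e)\<in>states P. node_cost S)"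
    using backtrack_spec[OF final_memo(1)[OF s] a b] by simp
  moreover have "running_time P C fit tm = clock m + \<tau>"
    by (simp add: running_time_def run_algorithm_def s b)
  ultimately show ?thesis
    using final_memo(3)[OF s] by (simp add: case_prod_unfold sum.distrib)
qed

end


section \<open>Optimality\<close>

lemma tree_objective_eq_sum_leaves:
  "tree_objective P t =
     (\<Sum>(L, \<theta>)\<leftarrow>leaves P t (obs P). loss P L \<theta> + penalty P * real (n_params P))"
proof -
  have "(\<Sum>(S, \<theta>)\<leftarrow>xs. \<Sum>i\<in>S. obs_loss P i \<theta>) + penalty P * real (length xs) * real (n_params P) =
      (\<Sum>(L, \<theta>)\<leftarrow>xs. loss P L \<theta> + penalty P * real (n_params P))" for xs
    by (induction xs) (auto simp: loss_def algebra_simps)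
  then show ?thesis
    by (simp add: tree_objective_def)
qed

lemma leaf_subset: "(L, \<theta>) \<in> set (leaves P t S) \<Longrightarrow> L \<subseteq> S"
  by (induction t arbitrary: S) (use branch_subset in fastforce)+

lemma leaves_nonempty: "leaves P t S \<noteq> []"
  by (induction t arbitrary: S) auto

lemma min_leaf_le_card_if_leaves:
  assumes "finite S" "\<forall>(L, \<theta>) \<in> set (leaves P t S). min_leaf P \<le> card L"
  shows "min_leaf P \<le> card S"
proof -
  obtain L \<theta> where "(L, \<theta>) \<in> set (leaves P t S)"
    using leaves_nonempty by (metis last_in_set surj_pair)
  then show ?thesis
    using assms leaf_subset[of L \<theta> P t S] card_mono[of S L] by fastforce
qed

context tree_dp
begin

text \<open>
  The Bellman inequalities, chained down a competing tree. The competitor is only required to have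
  leaves that are large enough; its splits are then admissible, so the memo has compared the cached
  value with each of them.
\<close>

lemma cached_value_le:
  fixes t :: "('f candidate, ('j, 'f) param) tree"
  assumes fit_le: "\<And>S \<theta>. S \<subseteq> obs P \<Longrightarrow> min_leaf P \<le> card S \<Longrightarrow> \<theta> \<in> feasible_params P \<Longrightarrow>
      fst (fit S) \<le> loss P S \<theta> + penalty P * real (n_params P)"
    and cons: "consistent m" and "state_cache m (S, d) = Some (v, a)"
    and "d + depth t \<le> max_depth P" "splits t \<subseteq> set (cands P)"
    and "\<forall>(L, \<theta>) \<in> set (leaves P t S). min_leaf P \<le> card L \<and> \<theta> \<in> feasible_params P"
  shows "v \<le> ereal (\<Sum>(L, \<theta>)\<leftarrow>leaves P t S. loss P L \<theta> + penalty P * real (n_params P))"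
  using assms(3-)
proof (induction t arbitrary: S d v a)
  case (Leaf \<theta>)
  have st: "(S, d) \<in> states P" and "v \<le> ereal (fst (fit S))"
    using cons Leaf.prems(1) by (auto simp: consistent_def bellman_def)
  note this(2)
  also have "ereal (fst (fit S)) \<le> ereal (loss P S \<theta> + penalty P * real (n_params P))"
    using fit_le[OF states_subset_obs[OF st] states_min_leaf[OF st]] Leaf.prems(4) by simp
  finally show ?case
    by simp
next
  case (Node f l r)
  have st: "(S, d) \<in> states P" and bell: "bellman m S d v a"
    using cons Node.prems(1) by (auto simp: consistent_def)
  have "finite S"
    using states_subset_obs[OF st] valid finite_subset by (auto simp: valid_problem_def)
  then have fin: "finite (branch P S f b)" for b
    using branch_subset finite_subset by metis
  have "min_leaf P \<le> card (branch P S f False)"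
    by (rule min_leaf_le_card_if_leaves[OF fin, where t = l]) (use Node.prems(4) in auto)
  moreover have "min_leaf P \<le> card (branch P S f True)"
    by (rule min_leaf_le_card_if_leaves[OF fin, where t = r]) (use Node.prems(4) in auto)
  ultimately have "f \<in> admissible P S d"
    using Node.prems(2,3) by (auto simp: admissible_def)
  then obtain v0 a0 v1 a1 where v:
    "state_cache m (branch P S f False, Suc d) = Some (v0, a0)"
    "state_cache m (branch P S f True, Suc d) = Some (v1, a1)" "v \<le> v0 + v1"
    using bell unfolding bellman_def split_value_def by blast
  note v(3)
  also have "v0 + v1 \<le>
      ereal (\<Sum>(L, \<theta>)\<leftarrow>leaves P l (branch P S f False). loss P L \<theta> + penalty P * real (n_params P)) +
      ereal (\<Sum>(L, \<theta>)\<leftarrow>leaves P r (branch P S f True). loss P L \<theta> + penalty P * real (n_params P))"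
    using Node.prems by (intro add_mono Node.IH[OF v(1)] Node.IH[OF v(2)]) auto
  finally show ?case
    by simp
qed

end

lemma returned_tree_optimal:
  assumes "valid_cost_model C" "valid_problem P" "exact_fit P fit"
  shows "optimal_tree P (returned_tree P C fit tm)"
proof -
  interpret tree_dp P C fit tm
    by (rule tree_dp.intro) (fact assms)+
  obtain v m where s: "solve_state P C fit tm (obs P) 0 empty_memo = (v, m)"
    by force
  obtain t \<tau> where b: "backtrack P C m (obs P) 0 = (t, \<tau>)"
    by force
  obtain a where a: "state_cache m (obs P, 0) = Some (v, a)"
    using final_memo(2)[OF s] by blast
  note m = final_memo(1)[OF s]
  note spec = backtrack_spec[OF m a b]
  have ret: "returned_tree P C fit tm = t"
    by (simp add: returned_tree_def run_algorithm_def s b)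
  have leaf: "min_leaf P \<le> card L \<and> \<theta> \<in> feasible_params P \<and>
      fst (fit L) = loss P L \<theta> + penalty P * real (n_params P)"
    if "(L, \<theta>) \<in> set (leaves P t (obs P))" for L \<theta>
  proof -
    have L: "L \<subseteq> obs P" "min_leaf P \<le> card L" "\<theta> = snd (fit L)"
      using spec that by auto
    then have "ereal (fst (fit L)) = ereal (loss P L \<theta> + penalty P * real (n_params P))"
        "\<theta> \<in> feasible_params P"
      using assms(3) unfolding exact_fit_def by (auto simp: case_prod_unfold)
    then show ?thesis
      using L(2) by simp
  qed
  have "feasible_tree P t"
    unfolding feasible_tree_def using spec leaf by auto
  have "(\<Sum>(L, \<theta>)\<leftarrow>leaves P t (obs P). fst (fit L)) = tree_objective P t"
    unfolding tree_objective_eq_sum_leaves using leaf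
    by (intro arg_cong[where f = sum_list] map_cong) auto
  then have v: "v = ereal (tree_objective P t)"
    using spec by simp
  have "fst (fit S) \<le> loss P S \<theta> + penalty P * real (n_params P)"
    if "S \<subseteq> obs P" "min_leaf P \<le> card S" "\<theta> \<in> feasible_params P" for S \<theta>
  proof -
    have "ereal (fst (fit S)) = leaf_cost P S"
      using assms(3) that(1,2) unfolding exact_fit_def by (auto simp: case_prod_unfold)
    also have "\<dots> \<le> ereal (loss P S \<theta> + penalty P * real (n_params P))"
      using that(2,3) by (auto simp: leaf_cost_def intro: INF_lower)
    finally show ?thesis
      by simp
  qed
  then have "tree_objective P t \<le> tree_objective P t'" if "feasible_tree P t'" for t'
    using cached_value_le[OF _ m a, of t'] that
    unfolding v tree_objective_eq_sum_leaves[of P t'] feasible_tree_def by simp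
  then show ?thesis
    using \<open>feasible_tree P t\<close> unfolding ret optimal_tree_def by blast
qed


section \<open>Running time\<close>

text \<open>
  Over a principal filter the asymptotic bound holds on the whole set with a single constant.
\<close>

lemma bigo_principalE:
  fixes f g :: "'a \<Rightarrow> real"
  assumes "f \<in> O[principal A](g)"
  obtains c where "\<And>x. x \<in> A \<Longrightarrow> f x \<le> c * \<bar>g x\<bar>"
proof -
  obtain c where c: "\<And>x. x \<in> A \<Longrightarrow> norm (f x) \<le> c * norm (g x)"
    using assms unfolding bigo_def eventually_principal by blast
  have "f x \<le> c * \<bar>g x\<bar>" if "x \<in> A" for x
    using c[OF that] abs_ge_self[of "f x"] by (simp only: real_norm_def)
  then show thesis
    by (rule that)
qed

lemma valid_cost_model_bounds:
  assumes "valid_cost_model C"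
  obtains K where "0 \<le> K"
    "\<And>n. 1 \<le> n \<Longrightarrow> part_cost C n \<le> K * real n"
    "\<And>n k. 1 \<le> n \<Longrightarrow> 1 \<le> k \<Longrightarrow> deriv_cost C n k \<le> K * (real n * (real k)\<^sup>2)"
    "\<And>m k. 1 \<le> m \<Longrightarrow> 1 \<le> k \<Longrightarrow> con_cost C m k \<le> K * (real m * real k)"
proof -
  have big: "part_cost C \<in> O[principal {1..}](\<lambda>n. real n)"
    "(\<lambda>(n, k). deriv_cost C n k) \<in> O[principal ({1..} \<times> {1..})](\<lambda>(n, k). real n * (real k)\<^sup>2)"
    "(\<lambda>(m, k). con_cost C m k) \<in> O[principal ({1..} \<times> {1..})](\<lambda>(m, k). real m * real k)"
    using assms by (simp_all add: valid_cost_model_def)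
  obtain c1 where c1: "\<And>n. n \<in> {1..} \<Longrightarrow> part_cost C n \<le> c1 * \<bar>real n\<bar>"
    using bigo_principalE[OF big(1)] by blast
  obtain c2 where c2: "\<And>x. x \<in> {1..} \<times> {1..} \<Longrightarrow>
      (\<lambda>(n, k). deriv_cost C n k) x \<le> c2 * \<bar>(\<lambda>(n, k). real n * (real k)\<^sup>2) x\<bar>"
    using bigo_principalE[OF big(2)] by blast
  obtain c3 where c3: "\<And>x. x \<in> {1..} \<times> {1..} \<Longrightarrow>
      (\<lambda>(m, k). con_cost C m k) x \<le> c3 * \<bar>(\<lambda>(m, k). real m * real k) x\<bar>"
    using bigo_principalE[OF big(3)] by blast
  define K where "K = \<bar>c1\<bar> + \<bar>c2\<bar> + \<bar>c3\<bar>"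
  have K: "0 \<le> K" "c1 \<le> K" "c2 \<le> K" "c3 \<le> K"
    by (auto simp: K_def)
  show thesis
  proof (rule that[OF K(1)])
    fix n k :: nat
    assume n: "1 \<le> n"
    have "part_cost C n \<le> c1 * real n"
      using c1[of n] n by simp
    also have "\<dots> \<le> K * real n"
      by (intro mult_right_mono K) simp
    finally show "part_cost C n \<le> K * real n" .
    assume k: "1 \<le> k"
    have "deriv_cost C n k \<le> c2 * (real n * (real k)\<^sup>2)"
      using c2[of "(n, k)"] n k by (simp add: abs_mult)
    also have "\<dots> \<le> K * (real n * (real k)\<^sup>2)"
      by (intro mult_right_mono K) simp
    finally show "deriv_cost C n k \<le> K * (real n * (real k)\<^sup>2)" .
    have "con_cost C n k \<le> c3 * (real n * real k)"
      using c3[of "(n, k)"] n k by (simp add: abs_mult)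
    also have "\<dots> \<le> K * (real n * real k)"
      by (intro mult_right_mono K) simp
    finally show "con_cost C n k \<le> K * (real n * real k)" .
  qed
qed

text \<open>
  The asymptotic bounds of the cost model concern positive sizes only. The constraints
  on the price sensitivities make the number of constraints positive.
\<close>

lemma valid_problem_sizes:
  assumes "valid_problem P"
  shows "1 \<le> card (obs P)" "1 \<le> n_params P" "1 \<le> n_cons P"
proof -
  show "1 \<le> card (obs P)"
    using assms by (auto simp: valid_problem_def)
  show "1 \<le> n_params P"
    using assms by (auto simp: valid_problem_def n_params_def Suc_le_eq card_gt_0_iff)
  obtain j where "j \<in> products P"
    using assms by (auto simp: valid_problem_def)
  then obtain r where "r < n_cons P"
    using assms unfolding valid_problem_def by blast
  then show "1 \<le> n_cons P"
    by simp
qed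

lemma n_iterations_le_max_newton:
  assumes "finite (obs P)" "S \<subseteq> obs P" "min_leaf P \<le> card S"
  shows "n_iterations (run S) \<le> max_newton P run (card (obs P))"
  unfolding max_newton_def using assms by (intro Max_ge) (auto intro: card_mono)

text \<open>
  In the following proof \<open>I\<close> is the cost of one Newton iteration in the formula and \<open>M\<close> the largest
  number of iterations. Every run has an iteration and there is a parameter, so
  $1 \le N \le M I$: this term absorbs the unit steps and the partition cost of the recovery, even
  if there are no candidates. The unit steps and partitions of the loop are absorbed by $F N$.
\<close>

lemma running_time_le_time_bound:
  fixes C :: cost_model
  assumes C: "valid_cost_model C"
  obtains K where "\<And>(P :: ('i, 'j, 'f) problem) \<epsilon> run. valid_problem P \<Longrightarrow> newton_solver P \<epsilon> run \<Longrightarrow>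
    \<bar>running_time P C (newton_fit P run) (newton_time P C \<epsilon> run)\<bar> \<le> K * time_bound P C \<epsilon> run"
proof -
  obtain K where K: "0 \<le> K"
    "\<And>n. 1 \<le> n \<Longrightarrow> part_cost C n \<le> K * real n"
    "\<And>n k. 1 \<le> n \<Longrightarrow> 1 \<le> k \<Longrightarrow> deriv_cost C n k \<le> K * (real n * (real k)\<^sup>2)"
    "\<And>m k. 1 \<le> m \<Longrightarrow> 1 \<le> k \<Longrightarrow> con_cost C m k \<le> K * (real m * real k)"
    using valid_cost_model_bounds[OF C] by blast
  define s where "s = step_cost C"
  have s: "0 \<le> s"
    using C by (simp add: s_def valid_cost_model_def)
  \<comment> \<open>The coefficient of \<open>M * I\<close>: a unit step, the Newton fit (\<open>K + 1\<close>, as the cost of the quadratic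
      programs has coefficient one) and, for the recovery, a unit step and a partition.\<close>
  define K' where "K' = 2 * s + 2 * K + 1"
  have "\<bar>running_time P C (newton_fit P run) (newton_time P C \<epsilon> run)\<bar> \<le> K' * time_bound P C \<epsilon> run"
    if P: "valid_problem P" and run: "newton_solver P \<epsilon> run"
    for P :: "('i, 'j, 'f) problem" and \<epsilon> run
  proof -
    interpret tree_dp P C "newton_fit P run" "newton_time P C \<epsilon> run"
      by (rule tree_dp.intro) (fact P C)+
    define N where "N = real (card (obs P))"
    define N0 where "N0 = real (n_params P)"
    define F where "F = real (card (set (cands P)))"
    define M where "M = real (max_newton P run (card (obs P)))"
    define q where "q = qp_cost C (n_params P) (n_cons P) \<epsilon>"
    define I where "I = N * N0\<^sup>2 + real (n_cons P) * N0 + q"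
    note sizes = valid_problem_sizes[OF P]
    have N: "1 \<le> N" and N0: "1 \<le> N0"
      using sizes unfolding N_def N0_def by linarith+
    have fin: "finite (obs P)" and obs: "min_leaf P \<le> card (obs P)"
      using P by (auto simp: valid_problem_def)
    have F: "real (length (cands P)) = F" "0 \<le> F"
      using P by (auto simp: F_def valid_problem_def distinct_card)
    have q: "0 \<le> q"
      using C by (simp add: q_def valid_cost_model_def)
    have "2 \<le> length (run (obs P))"
      using run obs by (auto simp: newton_solver_def newton_run_def)
    then have "1 \<le> n_iterations (run (obs P))"
      by (simp add: n_iterations_def)
    then have M: "1 \<le> M"
      using n_iterations_le_max_newton[OF fin subset_refl obs, of run] unfolding M_def by linarith
    have "N * 1 \<le> N * N0\<^sup>2"
      using N N0 by (intro mult_left_mono) auto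
    moreover have "0 \<le> real (n_cons P) * N0"
      using N0 by simp
    ultimately have NI: "N \<le> I"
      using q unfolding I_def by linarith
    have "I * 1 \<le> M * I"
      using mult_right_mono[OF M, of I] NI N by simp
    then have NMI: "N \<le> M * I"
      using NI by simp
    have per_state: "state_cost S + node_cost S \<le> K' * (M * I + F * N)" if "(S, d) \<in> states P" for S d
    proof -
      have S: "S \<subseteq> obs P" "min_leaf P \<le> card S"
        using states_subset_obs[OF that] states_min_leaf[OF that] by auto
      have S1: "1 \<le> card S" and SN: "real (card S) \<le> N"
        using S min_leaf_pos card_mono[OF fin S(1)] by (auto simp: N_def)
      have part: "part_cost C (card S) \<le> K * N"
        using K(2)[OF S1] mult_left_mono[OF SN K(1)] by linarith
      have "real (card S) * N0\<^sup>2 \<le> N * N0\<^sup>2"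
        using SN by (intro mult_right_mono) auto
      then have deriv: "deriv_cost C (card S) (n_params P) \<le> K * (N * N0\<^sup>2)"
        using K(3)[OF S1 sizes(2)] mult_left_mono[OF _ K(1)] unfolding N0_def by (smt (verit))
      have con: "con_cost C (n_cons P) (n_params P) \<le> K * (real (n_cons P) * N0)"
        using K(4)[OF sizes(3,2)] by (simp add: N0_def)
      let ?it = "deriv_cost C (card S) (n_params P) + con_cost C (n_cons P) (n_params P) + q"
      have it: "0 \<le> ?it"
        using C q by (simp add: valid_cost_model_def)
      have "0 \<le> K * q"
        using K(1) q by simp
      then have "?it \<le> K * I + q"
        using deriv con unfolding I_def distrib_left by linarith
      also have "\<dots> \<le> (K + 1) * I"
        using N N0 unfolding distrib_right I_def by simp
      finally have it_le: "?it \<le> (K + 1) * I" .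
      have "real (n_iterations (run S)) \<le> M"
        using n_iterations_le_max_newton[OF fin S, of run] by (simp add: M_def)
      then have "real (n_iterations (run S)) * ?it \<le> M * ((K + 1) * I)"
        using it it_le M by (intro mult_mono) auto
      moreover have "\<bar>newton_time P C \<epsilon> run S\<bar> = real (n_iterations (run S)) * ?it"
        using it by (simp add: newton_time_def q_def)
      ultimately have newton: "\<bar>newton_time P C \<epsilon> run S\<bar> \<le> (K + 1) * (M * I)"
        by (simp add: algebra_simps)
      have one: "s \<le> s * (M * I)"
        using mult_left_mono[of 1 "M * I" s] s NMI N by simp
      have "s \<le> s * N"
        using mult_left_mono[of 1 N s] s N by simp
      then have "F * (s + part_cost C (card S)) \<le> F * ((s + K) * N)"
        using part F(2) by (intro mult_left_mono) (auto simp: algebra_simps)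
      then have cand: "F * (s + part_cost C (card S)) \<le> (s + K) * (F * N)"
        by (simp add: algebra_simps)
      have partI: "part_cost C (card S) \<le> K * (M * I)"
        using part mult_left_mono[OF NMI K(1)] by linarith
      have "state_cost S + node_cost S \<le>
          s * (M * I) + (K + 1) * (M * I) + (s + K) * (F * N) + (s * (M * I) + K * (M * I))"
        using one newton cand partI unfolding state_cost_def node_cost_def s_def[symmetric] F(1)
        by linarith
      also have "\<dots> = K' * (M * I) + (s + K) * (F * N)"
        by (simp add: K'_def algebra_simps)
      also have "\<dots> \<le> K' * (M * I) + K' * (F * N)"
        using s K(1) F(2) N by (intro add_left_mono mult_right_mono) (auto simp: K'_def)
      finally show ?thesis
        by (simp add: distrib_left)
    qed
    have nonneg: "0 \<le> K' * (M * I + F * N)"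
      using s K(1) NMI N F(2) by (simp add: K'_def)
    have "\<bar>running_time P C (newton_fit P run) (newton_time P C \<epsilon> run)\<bar>
        \<le> (\<Sum>(S, d)\<in>states P. state_cost S + node_cost S)"
      by (rule running_time_le)
    also have "\<dots> \<le> real (card (states P)) * (K' * (M * I + F * N))"
      using per_state by (intro sum_bounded_above) auto
    also have "\<dots> \<le> real (\<Sum>d=0..max_depth P. (card (set (cands P)) choose d) * 2 ^ d) *
        (K' * (M * I + F * N))"
      using card_states_le nonneg by (intro mult_right_mono of_nat_mono)
    also have "\<dots> = K' * time_bound P C \<epsilon> run"
      by (simp add: time_bound_def Let_def N_def N0_def F_def M_def I_def q_def)
    finally show ?thesis .
  qed
  then show thesis
    by (rule that)
qed

theorem theorem1:
  fixes C :: cost_model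
  assumes "valid_cost_model C"
  shows "(\<forall>(P :: ('i, 'j, 'f) problem) fit tm. valid_problem P \<and> exact_fit P fit \<longrightarrow>
            optimal_tree P (returned_tree P C fit tm)) \<and>
         (\<lambda>(P :: ('i, 'j, 'f) problem, \<epsilon>, run).
            running_time P C (newton_fit P run) (newton_time P C \<epsilon> run))
         \<in> O[principal {(P, \<epsilon>, run). valid_problem P \<and> 0 < \<epsilon> \<and> newton_solver P \<epsilon> run}](
               \<lambda>(P, \<epsilon>, run). time_bound P C \<epsilon> run)"
proof (intro conjI allI impI)
  show "optimal_tree P (returned_tree P C fit tm)" if "valid_problem P \<and> exact_fit P fit"
    for P :: "('i, 'j, 'f) problem" and fit tm
    using returned_tree_optimal assms that by blast
next
  obtain K where K: "\<And>(P :: ('i, 'j, 'f) problem) \<epsilon> run. valid_problem P \<Longrightarrow> newton_solver P \<epsilon> run \<Longrightarrow>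
      \<bar>running_time P C (newton_fit P run) (newton_time P C \<epsilon> run)\<bar> \<le> K * time_bound P C \<epsilon> run"
    using running_time_le_time_bound[OF assms] by blast
  have "K * x \<le> \<bar>K\<bar> * \<bar>x\<bar>" for x
    by (metis abs_ge_self abs_mult)
  then have "\<bar>running_time P C (newton_fit P run) (newton_time P C \<epsilon> run)\<bar>
      \<le> \<bar>K\<bar> * \<bar>time_bound P C \<epsilon> run\<bar>"
    if "valid_problem P" "newton_solver P \<epsilon> run" for P :: "('i, 'j, 'f) problem" and \<epsilon> run
    using K[OF that] order_trans by blast
  then show "(\<lambda>(P :: ('i, 'j, 'f) problem, \<epsilon>, run).
            running_time P C (newton_fit P run) (newton_time P C \<epsilon> run))
         \<in> O[principal {(P, \<epsilon>, run). valid_problem P \<and> 0 < \<epsilon> \<and> newton_solver P \<epsilon> run}](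
               \<lambda>(P, \<epsilon>, run). time_bound P C \<epsilon> run)"
    by (intro bigoI[of _ "\<bar>K\<bar>"]) (auto simp: eventually_principal)
qed

end
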